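(* Assume that the numerical integration is exact (all time integrals in the asynchronous scheme described in the context are computed exactly). Then the asynchronous scheme exactly conserves the following pseudo-energy at the coarse time nodes $t^n$: $$\tilde{H}^{n} = V_S(\bm{q}_S^n) + V_M(\bm{q}_M^{n,0},\bm{q}_S^{n}) + V_F(\bm{q}_F^{n,0},\bm{q}_M^{n,0}) + \sum_{i\in S} \frac{1}{2m_i} \left(p_{i}^{n-1/2}\right)^{\mathrm{T}} p_i^{n+1/2}+ \sum_{i\in F\cup M} \frac{1}{2m_i} \left(p_i^{n,-1/2}\right)^{\mathrm{T}} p_i^{n,1/2},$$ that is, $\tilde H^{n+1}=\tilde H^n$ for all $n\ge 0$.
   Context: Consider $N$ particles in dimension $d$, with positions $q_i\in\mathbb{R}^d$, momenta $p_i\in\mathbb{R}^d$ and masses $m_i>0$ (the mass matrix is diagonal). The index set $\{1,\dots,N\}$ is partitioned into three sets $S$ (slow), $M$ (mixed) and $F$ (fast); $\bm{q}_S,\bm{q}_M,\bm{q}_F$ denote the corresponding position vectors. The potential decomposes as $$V(\bm{q}) = V_S(\bm{q}_S) + V_M(\bm{q}_M,\bm{q}_S) + V_F(\bm{q}_F,\bm{q}_M),$$ with $V_S,V_M,V_F$ real-valued functions of class $C^2$; $\frac{\partial}{\partial q_i}$ denotes the gradient with respect to $q_i\in\mathbb{R}^d$. The constant time-steps satisfy $h_S=Kh_F$ with $h_F>0$ and $K\ge 1$ an integer. Coarse nodes: $t^n=nh_S$; fine nodes: $t^{n,m}=t^n+mh_F$, $m\in\{0,\dots,K\}$. Asynchronous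 scheme on $[t^n,t^{n+1}]$, $n\ge0$. Known are $(p_i^{n-1/2},q_i^n,p_i^{n+1/2})$ for $i\in S$ and $(p_i^{n,-1/2},q_i^{n,0},p_i^{n,1/2})$ for $i\in F\cup M$. Free-flight trajectories are $$\hat{q}_{j}^{n,m}(t) = q_j^{n,m}+\tfrac{1}{m_j}p_j^{n,m+1/2}(t-t^{n,m}),\quad t\in[t^{n,m},t^{n,m+1}],\ j\in F\cup M,$$ $$\hat{q}_{j}^{n}(t) = q_j^{n}+\tfrac{1}{m_{j}}p_{j}^{n+1/2}(t-t^{n}),\quad t\in[t^{n},t^{n+1}],\ j\in S,$$ and $\bm{\hat q}_F^{n,m},\bm{\hat q}_M^{n,m},\bm{\hat q}_S^{n}$ are the corresponding vectors. (i) For $i\in F$ and $m=0,\dots,K-1$: $$q_i^{n,m+1} = q_i^{n,m} + h_F\tfrac{1}{m_i}p_i^{n,m+1/2},\qquad p_i^{n,m+3/2} = p_i^{n,m-1/2}-2\int_{t^{n,m}}^{t^{n,m+1}} \frac{\partial V_F}{\partial q_i}(\bm{\hat{q}}_{F}^{n,m}(t),\bm{\hat{q}}_{M}^{n,m}(t))\, dt.$$ (ii) For $i\in M$ and $m=0,\dots,K-1$: $$q_i^{n,m+1} = q_i^{n,m} + h_F\tfrac{1}{m_i}p_i^{n,m+1/2},$$ $$p_i^{n,m+3/2} = p_i^{n,m-1/2}-2\int_{t^{n,m}}^{t^{n,m+1}} \left(\frac{\partial V_F}{\partial q_i}(\bm{\hat{q}}_{F}^{n,m}(t),\bm{\hat{q}}_{M}^{n,m}(t))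 + \frac{\partial V_M}{\partial q_i}(\bm{\hat{q}}_{M}^{n,m}(t),\bm{\hat{q}}_{S}^n(t))\right) dt.$$ (iii) For $i\in S$: $$q_i^{n+1} = q_i^n + h_S\tfrac{1}{m_i}p_i^{n+1/2},$$ $$p_i^{n+3/2} = p_i^{n-1/2}-2\sum_{m=0}^{K-1}\int_{t^{n,m}}^{t^{n,m+1}}\frac{\partial V_M}{\partial q_i}(\bm{\hat{q}}_{M}^{n,m}(t),\bm{\hat{q}}_{S}^n(t))\,dt -2\int_{t^n}^{t^{n+1}} \frac{\partial V_S}{\partial q_i}(\bm{\hat{q}}_{S}^n(t))\, dt.$$ For $i\in F\cup M$ the next coarse step starts from the values at the end of the current one: $q_i^{n+1,0}=q_i^{n,K}$, $p_i^{n+1,-1/2}=p_i^{n,K-1/2}$, $p_i^{n+1,1/2}=p_i^{n,K+1/2}$. *)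

theory Defs
  imports "HOL-Analysis.Analysis"
begin

definition C2 :: "('a::real_normed_vector \<Rightarrow> real) \<Rightarrow> bool" where
  "C2 f \<longleftrightarrow> (\<exists>(f' :: 'a \<Rightarrow> 'a \<Rightarrow>\<^sub>L real) (f'' :: 'a \<Rightarrow> 'a \<Rightarrow>\<^sub>L 'a \<Rightarrow>\<^sub>L real).
     (\<forall>x. (f has_derivative blinfun_apply (f' x)) (at x)) \<and>
     (\<forall>x. (f' has_derivative blinfun_apply (f'' x)) (at x)) \<and>
     continuous_on UNIV f'')"

(* Particles are indexed by a finite type 'i (so N = CARD('i)), the space dimension is
   d = CARD('d), and a family of one vector of R^d per particle has type real^'d^'i.
   The subvector of the particles in A, such as \<open>q\<^sub>S\<close>, is the family with the components
   outside A set to 0; it ranges over a copy of R^(d |A|), and A may be empty.  The potentials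
   are only ever evaluated on such subvectors. *)
definition block :: "'i set \<Rightarrow> real^'d^'i \<Rightarrow> real^'d^'i" where
  "block A q = (\<chi> i. if i \<in> A then q $ i else 0)"

definition grad_wrt :: "'i \<Rightarrow> (real^'d^'i \<Rightarrow> real) \<Rightarrow> real^'d^'i \<Rightarrow> real^'d" where
  "grad_wrt i f q = (THE D. GDERIV (\<lambda>x. f (\<chi> j. if j = i then x else q $ j)) (q $ i) :> D)"

definition coarse_node :: "real \<Rightarrow> nat \<Rightarrow> real" where
  "coarse_node hS n = real n * hS"

definition fine_node :: "real \<Rightarrow> real \<Rightarrow> nat \<Rightarrow> nat \<Rightarrow> real" where
  "fine_node hS hF n m = coarse_node hS n + real m * hF"

(* Half-integer time indices are shifted up by one half:
     qs n   is  q^n,      ps n   is  p^(n-1/2)     (used for particles in S),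
     qf n m is  q^(n,m),  pf n m is  p^(n,m-1/2)   (used for particles in F and M). *)

definition free_flight ::
    "('i \<Rightarrow> real) \<Rightarrow> real^'d^'i \<Rightarrow> real^'d^'i \<Rightarrow> real \<Rightarrow> real \<Rightarrow> real^'d^'i" where
  "free_flight mass q p t0 t = (\<chi> j. q $ j + ((t - t0) / mass j) *\<^sub>R p $ j)"

definition hat_fine where
  "hat_fine mass hS hF qf pf A n m t =
     block A (free_flight mass (qf n m) (pf n (m + 1)) (fine_node hS hF n m) t)"

definition hat_coarse where
  "hat_coarse mass hS qs ps A n t =
     block A (free_flight mass (qs n) (ps (n + 1)) (coarse_node hS n) t)"

definition async_scheme ::
    "'i set \<Rightarrow> 'i set \<Rightarrow> 'i set \<Rightarrow> ('i \<Rightarrow> real) \<Rightarrow>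
     (real^'d^'i \<Rightarrow> real) \<Rightarrow> (real^'d^'i \<Rightarrow> real^'d^'i \<Rightarrow> real) \<Rightarrow>
     (real^'d^'i \<Rightarrow> real^'d^'i \<Rightarrow> real) \<Rightarrow> real \<Rightarrow> real \<Rightarrow> nat \<Rightarrow>
     (nat \<Rightarrow> real^'d^'i) \<Rightarrow> (nat \<Rightarrow> real^'d^'i) \<Rightarrow>
     (nat \<Rightarrow> nat \<Rightarrow> real^'d^'i) \<Rightarrow> (nat \<Rightarrow> nat \<Rightarrow> real^'d^'i) \<Rightarrow> bool" where
  "async_scheme S M F mass V_S V_M V_F hS hF K qs ps qf pf \<longleftrightarrow>
   (let tc = coarse_node hS;
        tf = fine_node hS hF;
        hatF = hat_fine mass hS hF qf pf F;
        hatM = hat_fine mass hS hF qf pf M;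
        hatS = hat_coarse mass hS qs ps S
    in \<forall>n.
     (\<forall>i\<in>F. \<forall>m<K.
        qf n (m + 1) $ i = qf n m $ i + (hF / mass i) *\<^sub>R pf n (m + 1) $ i \<and>
        pf n (m + 2) $ i = pf n m $ i - 2 *\<^sub>R
          integral {tf n m .. tf n (m + 1)}
            (\<lambda>t. grad_wrt i (\<lambda>x. V_F x (hatM n m t)) (hatF n m t))) \<and>
     (\<forall>i\<in>M. \<forall>m<K.
        qf n (m + 1) $ i = qf n m $ i + (hF / mass i) *\<^sub>R pf n (m + 1) $ i \<and>
        pf n (m + 2) $ i = pf n m $ i - 2 *\<^sub>R
          integral {tf n m .. tf n (m + 1)}
            (\<lambda>t. grad_wrt i (\<lambda>x. V_F (hatF n m t) x) (hatM n m t)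
               + grad_wrt i (\<lambda>x. V_M x (hatS n t)) (hatM n m t))) \<and>
     (\<forall>i\<in>S.
        qs (n + 1) $ i = qs n $ i + (hS / mass i) *\<^sub>R ps (n + 1) $ i \<and>
        ps (n + 2) $ i = ps n $ i
          - 2 *\<^sub>R (\<Sum>m<K. integral {tf n m .. tf n (m + 1)}
              (\<lambda>t. grad_wrt i (\<lambda>x. V_M (hatM n m t) x) (hatS n t)))
          - 2 *\<^sub>R integral {tc n .. tc (n + 1)}
              (\<lambda>t. grad_wrt i V_S (hatS n t))) \<and>
     (\<forall>i\<in>F \<union> M.
        qf (n + 1) 0 $ i = qf n K $ i \<and>
        pf (n + 1) 0 $ i = pf n K $ i \<and>
        pf (n + 1) 1 $ i = pf n (K + 1) $ i))"

definition pseudo_energy ::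
    "'i set \<Rightarrow> 'i set \<Rightarrow> 'i set \<Rightarrow> ('i \<Rightarrow> real) \<Rightarrow>
     (real^'d^'i \<Rightarrow> real) \<Rightarrow> (real^'d^'i \<Rightarrow> real^'d^'i \<Rightarrow> real) \<Rightarrow>
     (real^'d^'i \<Rightarrow> real^'d^'i \<Rightarrow> real) \<Rightarrow>
     (nat \<Rightarrow> real^'d^'i) \<Rightarrow> (nat \<Rightarrow> real^'d^'i) \<Rightarrow>
     (nat \<Rightarrow> nat \<Rightarrow> real^'d^'i) \<Rightarrow> (nat \<Rightarrow> nat \<Rightarrow> real^'d^'i) \<Rightarrow> nat \<Rightarrow> real" where
  "pseudo_energy S M F mass V_S V_M V_F qs ps qf pf n =
     V_S (block S (qs n))
     + V_M (block M (qf n 0)) (block S (qs n))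
     + V_F (block F (qf n 0)) (block M (qf n 0))
     + (\<Sum>i\<in>S. 1 / (2 * mass i) * (ps n $ i \<bullet> ps (n + 1) $ i))
     + (\<Sum>i\<in>F \<union> M. 1 / (2 * mass i) * (pf n 0 $ i \<bullet> pf n 1 $ i))"

end

theory Submission
  imports Defs
begin

text \<open>
  Two facts make the pseudo-energy an exact invariant.

  The scheme is a leapfrog scheme in which a force is integrated exactly along the free flights.
  Along a free flight each particle has the constant velocity \<open>p / mass\<close>, with \<open>p\<close> the momentum in
  the middle of its step, so by the fundamental theorem of calculus the potential changes by the sum
  over the particles of \<open>(p / mass) \<bullet> I\<close>, with \<open>I\<close> the time integral of the partial gradient
  (\<open>pair_potential_difference\<close>, \<open>potential_difference\<close>).

  The kinetic term is the product of two consecutive half-step momenta. When it moves on by one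
  step, from \<open>p\<^sup>- \<bullet> p\<close> to \<open>p \<bullet> p\<^sup>+\<close> with \<open>p\<^sup>+ = p\<^sup>- - 2 I\<close>, it changes by \<open>-2 (p \<bullet> I)\<close>
  (\<open>leapfrog_kinetic_difference\<close>): after division by \<open>2 mass\<close> this is exactly the opposite of the
  particle's share in the change of potential.

  The fast and mixed particles thus balance on every fine step; what is left over is the power of
  \<open>V_M\<close> on the slow particles. Their momentum is constant during the whole coarse step, so these
  leftovers add up over the fine steps to the pairing of that one momentum with the sum of integrals
  in the momentum update of the slow particles, which cancels them. The positions fit together
  because each free flight ends at the next node.
\<close>

section \<open>Partial gradients and block vectors\<close>

lemma C2_imp_continuous_derivative:
  assumes "C2 f"
  obtains f' where "\<And>x. (f has_derivative blinfun_apply (f' x)) (at x)"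
    and "continuous_on UNIV f'"
proof -
  obtain f' :: "'a \<Rightarrow> 'a \<Rightarrow>\<^sub>L real" and f'' where
    f': "\<And>x. (f has_derivative blinfun_apply (f' x)) (at x)"
    and f'': "\<And>x. (f' has_derivative blinfun_apply (f'' x)) (at x)"
    using assms unfolding C2_def by blast
  have "continuous_on UNIV f'"
    by (rule has_derivative_continuous_on) (rule f'')
  with f' show thesis by (rule that)
qed

text \<open>As the partial gradient is a definite description, its value rests on existence and
  uniqueness: the Riesz vector of the restriction of the derivative to the coordinates of particle \<open>i\<close>
  is such a gradient, and gradients are unique.\<close>

lemma inner_grad_wrt:
  fixes V :: "real^'d^'i::finite \<Rightarrow> real"
  assumes "(V has_derivative D) (at q)"
  shows "v \<bullet> grad_wrt i V q = D (axis i v)"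
proof -
  let ?u = "\<lambda>x. (\<chi> j. if j = i then x else q $ j)"
  define G where "G = (\<Sum>b\<in>Basis. D (axis i b) *\<^sub>R b)"
  have lin_axis: "linear (axis i :: real^'d \<Rightarrow> real^'d^'i)"
    by (rule linearI) (auto simp: axis_def vec_eq_iff)
  have lin: "linear (\<lambda>v. D (axis i v))"
    using linear_compose[OF lin_axis has_derivative_linear[OF assms]] by (simp add: o_def)
  have G: "v \<bullet> G = D (axis i v)" for v
    by (subst (2) euclidean_representation[of v, symmetric])
      (simp add: G_def inner_sum_right linear_sum[OF lin] linear_scale[OF lin] mult.commute)
  have u_eq: "?u = (\<lambda>x. q + axis i (x - q $ i))"
    by (auto simp: fun_eq_iff vec_eq_iff axis_def)
  have "(?u has_derivative axis i) (at (q $ i))"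
    unfolding u_eq
    by (auto intro!: derivative_eq_intros linear_imp_has_derivative
        has_derivative_compose[where g = "axis i", OF _ linear_imp_has_derivative[OF lin_axis]])
  moreover have "?u (q $ i) = q"
    by (auto simp: vec_eq_iff)
  ultimately have "((\<lambda>x. V (?u x)) has_derivative (\<lambda>v. D (axis i v))) (at (q $ i))"
    using has_derivative_compose[of ?u "axis i" "q $ i" UNIV V D] assms by simp
  then have der: "GDERIV (\<lambda>x. V (?u x)) (q $ i) :> G"
    by (simp add: gderiv_def G)
  have "grad_wrt i V q = G"
    unfolding grad_wrt_def
  proof (rule the_equality)
    show "GDERIV (\<lambda>x. V (?u x)) (q $ i) :> G" by (rule der)
  next
    fix G' assume "GDERIV (\<lambda>x. V (?u x)) (q $ i) :> G'"
    then have "(\<lambda>v. v \<bullet> G') = (\<lambda>v. v \<bullet> G)"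
      using der unfolding gderiv_def by (rule has_derivative_unique)
    then show "G' = G"
      by (metis vector_eq_ldot)
  qed
  with G show ?thesis by simp
qed

lemma block_eq_sum_axis: "block A w = (\<Sum>i\<in>A. axis i (w $ i))"
  by (auto simp: block_def vec_eq_iff axis_def if_distrib[where f = "\<lambda>x. x $ _"] 
      sum.delta cong: if_cong)

lemma linear_block: "linear D \<Longrightarrow> D (block A w) = (\<Sum>i\<in>A. D (axis i (w $ i)))"
  by (simp add: block_eq_sum_axis linear_sum)

lemma block_cong: "(\<And>i. i \<in> A \<Longrightarrow> q $ i = q' $ i) \<Longrightarrow> block A q = block A q'"
  by (auto simp: block_def vec_eq_iff)

section \<open>Change of a potential along free flights\<close>

text \<open>The embedding \<open>e\<close> lets the same lemma serve a potential of one block and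
  each of the two arguments of a potential of two blocks.\<close>

lemma integral_power_eq_sum_grad_wrt:
  fixes V :: "real \<Rightarrow> real^'d^'i::finite \<Rightarrow> real"
    and D :: "real \<Rightarrow> 'a::real_normed_vector \<Rightarrow>\<^sub>L real"
  assumes der: "\<And>t. (V t has_derivative (\<lambda>w. blinfun_apply (D t) (e w))) (at (x t))"
    and cont: "continuous_on {a..b} D"
    and e: "bounded_linear e"
  shows "(\<lambda>t. grad_wrt i (V t) (x t)) integrable_on {a..b}"
    and "((\<lambda>t. blinfun_apply (D t) (e (block A w))) has_integral
           (\<Sum>i\<in>A. w $ i \<bullet> integral {a..b} (\<lambda>t. grad_wrt i (V t) (x t)))) {a..b}"
proof -
  have inner_grad: "v \<bullet> grad_wrt i (V t) (x t) = blinfun_apply (D t) (e (axis i v))" for v i t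
    by (rule inner_grad_wrt[OF der])
  have "continuous_on {a..b} (\<lambda>t. grad_wrt i (V t) (x t))" for i
    by (subst continuous_on_componentwise)
      (auto simp: inner_grad inner_commute[of "grad_wrt _ _ _"] intro!: continuous_intros cont)
  then show grad_int: "(\<lambda>t. grad_wrt i (V t) (x t)) integrable_on {a..b}" for i
    by (rule integrable_continuous_interval)
  have "((\<lambda>t. \<Sum>i\<in>A. w $ i \<bullet> grad_wrt i (V t) (x t)) has_integral
           (\<Sum>i\<in>A. w $ i \<bullet> integral {a..b} (\<lambda>t. grad_wrt i (V t) (x t)))) {a..b}"
    by (intro has_integral_sum finite
        has_integral_linear[OF integrable_integral[OF grad_int], unfolded o_def]
        bounded_linear_inner_right)
  moreover have "(\<Sum>i\<in>A. w $ i \<bullet> grad_wrt i (V t) (x t)) = blinfun_apply (D t) (e (block A w))" for t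
    using linear_block[OF has_derivative_linear[OF der[of t]], of A w] by (simp add: inner_grad)
  ultimately show "((\<lambda>t. blinfun_apply (D t) (e (block A w))) has_integral
           (\<Sum>i\<in>A. w $ i \<bullet> integral {a..b} (\<lambda>t. grad_wrt i (V t) (x t)))) {a..b}"
    by simp
qed

definition velocity :: "('i::finite \<Rightarrow> real) \<Rightarrow> real^'d^'i \<Rightarrow> real^'d^'i" where
  "velocity mass p = (\<chi> j. (1 / mass j) *\<^sub>R p $ j)"

lemma has_vector_derivative_block_free_flight:
  "((\<lambda>t. block A (free_flight mass q p s t)) has_vector_derivative block A (velocity mass p)) (at t within T)"
proof -
  have "block A (free_flight mass q p s t) = block A q + (t - s) *\<^sub>R block A (velocity mass p)" for t
    by (auto simp: vec_eq_iff block_def free_flight_def velocity_def)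
  then show ?thesis
    by (auto intro!: derivative_eq_intros)
qed

lemma velocity_sum:
  "(\<Sum>i\<in>A. velocity mass p $ i \<bullet> G i) = (\<Sum>i\<in>A. (1 / mass i) * (p $ i \<bullet> G i))"
  by (simp add: velocity_def)

lemma potential_difference:
  fixes V :: "real^'d^'i::finite \<Rightarrow> real" and q p :: "real^'d^'i" and mass :: "'i \<Rightarrow> real"
    and A :: "'i set" and a b s :: real
  assumes "C2 V" and "a \<le> b"
  defines "x \<equiv> \<lambda>t. block A (free_flight mass q p s t)"
  shows "V (x b) - V (x a) =
           (\<Sum>i\<in>A. (1 / mass i) * (p $ i \<bullet> integral {a..b} (\<lambda>t. grad_wrt i V (x t))))"
proof -
  obtain V' where V': "\<And>x. (V has_derivative blinfun_apply (V' x)) (at x)"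
    and V'_cont: "continuous_on UNIV V'"
    using C2_imp_continuous_derivative[OF assms(1)] by blast
  have x': "(x has_vector_derivative block A (velocity mass p)) (at t within T)" for t T
    unfolding x_def by (rule has_vector_derivative_block_free_flight)
  then have "continuous_on {a..b} x"
    by (meson continuous_on_eq_continuous_within has_vector_derivative_continuous)
  then have cont: "continuous_on {a..b} (\<lambda>t. V' (x t))"
    using continuous_on_compose2[OF V'_cont] by blast
  have "((\<lambda>t. blinfun_apply (V' (x t)) (block A (velocity mass p))) has_integral V (x b) - V (x a)) {a..b}"
  proof (rule fundamental_theorem_of_calculus[OF assms(2)])
    show "((\<lambda>t. V (x t)) has_vector_derivative blinfun_apply (V' (x t)) (block A (velocity mass p)))
        (at t within {a..b})" for t
      using vector_derivative_diff_chain_within[OF x' has_derivative_at_withinI[OF V']]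
      by (simp add: o_def)
  qed
  moreover have "((\<lambda>t. blinfun_apply (V' (x t)) (block A (velocity mass p))) has_integral
      (\<Sum>i\<in>A. velocity mass p $ i \<bullet> integral {a..b} (\<lambda>t. grad_wrt i V (x t)))) {a..b}"
    using integral_power_eq_sum_grad_wrt(2)[where e = "\<lambda>w. w", OF V' cont bounded_linear_ident] .
  ultimately show ?thesis
    unfolding velocity_sum by (rule has_integral_unique)
qed

text \<open>A mixed particle feels two potentials, and the scheme integrates its total force. The
  integrability claims are what allows that integral to be split into one part per potential.\<close>

lemma pair_potential_difference:
  fixes V :: "real^'d^'i::finite \<Rightarrow> real^'d^'i \<Rightarrow> real" and q p q' p' :: "real^'d^'i"
    and mass :: "'i \<Rightarrow> real" and A B :: "'i set" and a b s s' :: real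
  assumes "C2 (\<lambda>(x, y). V x y)" and "a \<le> b"
  defines "x \<equiv> \<lambda>t. block A (free_flight mass q p s t)"
    and "y \<equiv> \<lambda>t. block B (free_flight mass q' p' s' t)"
  shows "(\<lambda>t. grad_wrt i (\<lambda>u. V u (y t)) (x t)) integrable_on {a..b}"
    and "(\<lambda>t. grad_wrt i (\<lambda>u. V (x t) u) (y t)) integrable_on {a..b}"
    and "V (x b) (y b) - V (x a) (y a) =
           (\<Sum>i\<in>A. (1 / mass i) * (p $ i \<bullet> integral {a..b} (\<lambda>t. grad_wrt i (\<lambda>u. V u (y t)) (x t))))
         + (\<Sum>i\<in>B. (1 / mass i) * (p' $ i \<bullet> integral {a..b} (\<lambda>t. grad_wrt i (\<lambda>u. V (x t) u) (y t))))"
proof -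
  obtain V' where V': "\<And>z. ((\<lambda>(x, y). V x y) has_derivative blinfun_apply (V' z)) (at z)"
    and V'_cont: "continuous_on UNIV V'"
    using C2_imp_continuous_derivative[OF assms(1)] by blast
  let ?z = "\<lambda>t. (x t, y t)"
  let ?z' = "(block A (velocity mass p), block B (velocity mass p'))"
  have x': "(x has_vector_derivative block A (velocity mass p)) (at t within T)"
    and y': "(y has_vector_derivative block B (velocity mass p')) (at t within T)" for t T
    unfolding x_def y_def by (rule has_vector_derivative_block_free_flight)+
  have z': "(?z has_vector_derivative ?z') (at t within T)" for t T
    by (rule has_vector_derivative_Pair[OF x' y'])
  then have "continuous_on {a..b} ?z"
    by (meson continuous_on_eq_continuous_within has_vector_derivative_continuous)
  then have cont: "continuous_on {a..b} (\<lambda>t. V' (?z t))"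
    using continuous_on_compose2[OF V'_cont] by blast
  have fst_slice: "((\<lambda>u. V u (y t)) has_derivative (\<lambda>w. blinfun_apply (V' (?z t)) (w, 0))) (at (x t))" for t
    using has_derivative_compose[OF has_derivative_Pair[OF has_derivative_ident has_derivative_const] V']
    by force
  have snd_slice: "((\<lambda>u. V (x t) u) has_derivative (\<lambda>w. blinfun_apply (V' (?z t)) (0, w))) (at (y t))" for t
    using has_derivative_compose[OF has_derivative_Pair[OF has_derivative_const has_derivative_ident] V']
    by force
  have emb1: "bounded_linear (\<lambda>w. (w, 0) :: (real^'d^'i) \<times> (real^'d^'i))"
    and emb2: "bounded_linear (\<lambda>w. (0, w) :: (real^'d^'i) \<times> (real^'d^'i))"
    by (intro bounded_linear_Pair bounded_linear_ident bounded_linear_zero)+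
  note power1 = integral_power_eq_sum_grad_wrt[OF fst_slice cont emb1]
  note power2 = integral_power_eq_sum_grad_wrt[OF snd_slice cont emb2]
  show "(\<lambda>t. grad_wrt i (\<lambda>u. V u (y t)) (x t)) integrable_on {a..b}" by (rule power1(1))
  show "(\<lambda>t. grad_wrt i (\<lambda>u. V (x t) u) (y t)) integrable_on {a..b}" by (rule power2(1))
  have "((\<lambda>t. blinfun_apply (V' (?z t)) ?z') has_integral V (x b) (y b) - V (x a) (y a)) {a..b}"
  proof (rule fundamental_theorem_of_calculus[OF assms(2)])
    show "((\<lambda>t. V (x t) (y t)) has_vector_derivative blinfun_apply (V' (?z t)) ?z')
        (at t within {a..b})" for t
      using vector_derivative_diff_chain_within[OF z' has_derivative_at_withinI[OF V']]
      by (simp add: o_def)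
  qed
  moreover have "blinfun_apply (V' (?z t)) (u, 0) + blinfun_apply (V' (?z t)) (0, v)
      = blinfun_apply (V' (?z t)) (u, v)" for t u v
    by (simp flip: blinfun.add_right)
  ultimately show "V (x b) (y b) - V (x a) (y a) =
           (\<Sum>i\<in>A. (1 / mass i) * (p $ i \<bullet> integral {a..b} (\<lambda>t. grad_wrt i (\<lambda>u. V u (y t)) (x t))))
         + (\<Sum>i\<in>B. (1 / mass i) * (p' $ i \<bullet> integral {a..b} (\<lambda>t. grad_wrt i (\<lambda>u. V (x t) u) (y t))))"
    using has_integral_add[OF power1(2)[of A "velocity mass p"] power2(2)[of B "velocity mass p'"]]
    unfolding velocity_sum by (simp add: has_integral_unique)
qed

section \<open>Balance of kinetic and potential terms\<close>

lemma leapfrog_kinetic_difference: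
  fixes p p_prev p_next I :: "'a::real_inner"
  assumes "p_next = p_prev - 2 *\<^sub>R I"
  shows "1 / (2 * \<mu>) * (p \<bullet> p_next) - 1 / (2 * \<mu>) * (p_prev \<bullet> p) = - ((1 / \<mu>) * (p \<bullet> I))"
  by (cases "\<mu> = 0") (simp_all add: assms inner_diff_right inner_commute field_simps)

theorem proposition9:
  fixes S M F :: "'i::finite set"
    and mass :: "'i \<Rightarrow> real"
    and V_S :: "real^'d^'i \<Rightarrow> real"
    and V_M V_F :: "real^'d^'i \<Rightarrow> real^'d^'i \<Rightarrow> real"
    and hS hF :: real
    and K :: nat
    and qs ps :: "nat \<Rightarrow> real^'d^'i"
    and qf pf :: "nat \<Rightarrow> nat \<Rightarrow> real^'d^'i"
  assumes "S \<union> M \<union> F = UNIV"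
    and "S \<inter> M = {}" and "S \<inter> F = {}" and "M \<inter> F = {}"
    and "\<And>i. mass i > 0"
    and "C2 V_S"
    and "C2 (\<lambda>(x, y). V_M x y)"
    and "C2 (\<lambda>(x, y). V_F x y)"
    and "hF > 0" and "K \<ge> 1" and "hS = real K * hF"
    and "async_scheme S M F mass V_S V_M V_F hS hF K qs ps qf pf"
  shows "\<forall>n. pseudo_energy S M F mass V_S V_M V_F qs ps qf pf (n + 1) =
             pseudo_energy S M F mass V_S V_M V_F qs ps qf pf n"
proof
  fix n
  let ?tc = "coarse_node hS" and ?tf = "fine_node hS hF"
  let ?hatF = "hat_fine mass hS hF qf pf F n"
    and ?hatM = "hat_fine mass hS hF qf pf M n"
    and ?hatS = "hat_coarse mass hS qs ps S n"
  \<comment> \<open>\<open>I_XY\<close> is the integrated force that the potential \<open>V_X\<close> exerts on a particle of the set \<open>Y\<close>.\<close>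
  define I_FF where "I_FF m i = integral {?tf n m .. ?tf n (m + 1)}
    (\<lambda>t. grad_wrt i (\<lambda>x. V_F x (?hatM m t)) (?hatF m t))" for m i
  define I_FM where "I_FM m i = integral {?tf n m .. ?tf n (m + 1)}
    (\<lambda>t. grad_wrt i (\<lambda>x. V_F (?hatF m t) x) (?hatM m t))" for m i
  define I_MM where "I_MM m i = integral {?tf n m .. ?tf n (m + 1)}
    (\<lambda>t. grad_wrt i (\<lambda>x. V_M x (?hatS t)) (?hatM m t))" for m i
  define I_MS where "I_MS m i = integral {?tf n m .. ?tf n (m + 1)}
    (\<lambda>t. grad_wrt i (\<lambda>x. V_M (?hatM m t) x) (?hatS t))" for m i
  define I_SS where "I_SS i = integral {?tc n .. ?tc (n + 1)}
    (\<lambda>t. grad_wrt i V_S (?hatS t))" for i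

  have fine_le: "?tf n m \<le> ?tf n (m + 1)" for m
    using \<open>hF > 0\<close> by (simp add: fine_node_def algebra_simps)
  have coarse_le: "?tc n \<le> ?tc (n + 1)"
    using \<open>hF > 0\<close> \<open>hS = real K * hF\<close> by (simp add: coarse_node_def algebra_simps)
  have tf_0: "?tf n 0 = ?tc n" and tf_K: "?tf n K = ?tc (n + 1)"
    using \<open>hS = real K * hF\<close> by (simp_all add: fine_node_def coarse_node_def algebra_simps)

  have F_step: "qf n (m + 1) $ i = qf n m $ i + (hF / mass i) *\<^sub>R pf n (m + 1) $ i"
      "pf n (m + 2) $ i = pf n m $ i - 2 *\<^sub>R I_FF m i" if "i \<in> F" "m < K" for i m
    using assms(12) that unfolding async_scheme_def Let_def I_FF_def by blast+
  \<comment> \<open>The scheme integrates the two forces on a mixed particle together, but each must be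
    matched with the change of its own potential.\<close>
  have M_split: "integral {?tf n m .. ?tf n (m + 1)}
      (\<lambda>t. grad_wrt i (\<lambda>x. V_F (?hatF m t) x) (?hatM m t) + grad_wrt i (\<lambda>x. V_M x (?hatS t)) (?hatM m t))
      = I_FM m i + I_MM m i" for i m
    unfolding I_FM_def I_MM_def hat_fine_def hat_coarse_def
    by (intro integral_add pair_potential_difference(1,2) fine_le assms(7,8))
  have M_step: "qf n (m + 1) $ i = qf n m $ i + (hF / mass i) *\<^sub>R pf n (m + 1) $ i"
      "pf n (m + 2) $ i = pf n m $ i - 2 *\<^sub>R (I_FM m i + I_MM m i)" if "i \<in> M" "m < K" for i m
    using assms(12) that unfolding async_scheme_def Let_def M_split[symmetric] by blast+
  have S_step: "qs (n + 1) $ i = qs n $ i + (hS / mass i) *\<^sub>R ps (n + 1) $ i"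
      "ps (n + 2) $ i = ps n $ i - 2 *\<^sub>R ((\<Sum>m<K. I_MS m i) + I_SS i)" if "i \<in> S" for i
  proof -
    show "qs (n + 1) $ i = qs n $ i + (hS / mass i) *\<^sub>R ps (n + 1) $ i"
      using assms(12) that unfolding async_scheme_def Let_def by blast
    have "ps (n + 2) $ i = ps n $ i - 2 *\<^sub>R (\<Sum>m<K. I_MS m i) - 2 *\<^sub>R I_SS i"
      using assms(12) that unfolding async_scheme_def Let_def I_MS_def I_SS_def by blast
    then show "ps (n + 2) $ i = ps n $ i - 2 *\<^sub>R ((\<Sum>m<K. I_MS m i) + I_SS i)"
      by (simp add: scaleR_add_right)
  qed
  have restart: "qf (n + 1) 0 $ i = qf n K $ i" "pf (n + 1) 0 $ i = pf n K $ i"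
      "pf (n + 1) 1 $ i = pf n (K + 1) $ i" if "i \<in> F \<union> M" for i
    using assms(12) that unfolding async_scheme_def Let_def by blast+

  have hatF_start: "?hatF m (?tf n m) = block F (qf n m)"
    and hatM_start: "?hatM m (?tf n m) = block M (qf n m)" for m
    by (auto simp: hat_fine_def free_flight_def intro!: block_cong)
  have hatF_end: "?hatF m (?tf n (m + 1)) = block F (qf n (m + 1))"
    and hatM_end: "?hatM m (?tf n (m + 1)) = block M (qf n (m + 1))" if "m < K" for m
    using F_step(1)[OF _ that] M_step(1)[OF _ that]
    by (auto simp: hat_fine_def free_flight_def fine_node_def algebra_simps intro!: block_cong)
  have hatS_start: "?hatS (?tc n) = block S (qs n)"
    by (auto simp: hat_coarse_def free_flight_def intro!: block_cong)
  have hatS_end: "?hatS (?tc (n + 1)) = block S (qs (n + 1))"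
    using S_step(1)
    by (auto simp: hat_coarse_def free_flight_def coarse_node_def algebra_simps intro!: block_cong)

  \<comment> \<open>The part of the energy that changes from fine step to fine step; in \<open>V_M\<close> the slow
    particles are taken on their free flight, between coarse nodes.\<close>
  define E where "E m = V_F (block F (qf n m)) (block M (qf n m)) + V_M (block M (qf n m)) (?hatS (?tf n m))
    + (\<Sum>i\<in>F \<union> M. 1 / (2 * mass i) * (pf n m $ i \<bullet> pf n (m + 1) $ i))" for m
  have E_step: "E (m + 1) - E m = (\<Sum>i\<in>S. (1 / mass i) * (ps (n + 1) $ i \<bullet> I_MS m i))" if m: "m < K" for m
  proof -
    have "V_F (block F (qf n (m + 1))) (block M (qf n (m + 1))) - V_F (block F (qf n m)) (block M (qf n m))
      = (\<Sum>i\<in>F. (1 / mass i) * (pf n (m + 1) $ i \<bullet> I_FF m i)) + (\<Sum>i\<in>M. (1 / mass i) * (pf n (m + 1) $ i \<bullet> I_FM m i))"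
      unfolding hatF_start[of m, symmetric] hatM_start[of m, symmetric] hatF_end[OF m, symmetric] hatM_end[OF m, symmetric]
        I_FF_def I_FM_def hat_fine_def
      by (rule pair_potential_difference(3)[OF assms(8) fine_le])
    moreover have "V_M (block M (qf n (m + 1))) (?hatS (?tf n (m + 1))) - V_M (block M (qf n m)) (?hatS (?tf n m))
      = (\<Sum>i\<in>M. (1 / mass i) * (pf n (m + 1) $ i \<bullet> I_MM m i)) + (\<Sum>i\<in>S. (1 / mass i) * (ps (n + 1) $ i \<bullet> I_MS m i))"
      unfolding hatM_start[of m, symmetric] hatM_end[OF m, symmetric]
        I_MM_def I_MS_def hat_fine_def hat_coarse_def
      by (rule pair_potential_difference(3)[OF assms(7) fine_le])
    moreover have "(\<Sum>i\<in>F \<union> M. 1 / (2 * mass i) * (pf n (m + 1) $ i \<bullet> pf n (m + 2) $ i))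
        - (\<Sum>i\<in>F \<union> M. 1 / (2 * mass i) * (pf n m $ i \<bullet> pf n (m + 1) $ i))
      = - (\<Sum>i\<in>F. (1 / mass i) * (pf n (m + 1) $ i \<bullet> I_FF m i))
        - (\<Sum>i\<in>M. (1 / mass i) * (pf n (m + 1) $ i \<bullet> I_FM m i))
        - (\<Sum>i\<in>M. (1 / mass i) * (pf n (m + 1) $ i \<bullet> I_MM m i))" (is "?kinetic = _")
    proof -
      have disjoint: "F \<inter> M = {}" using assms(4) by blast
      have "?kinetic = (\<Sum>i\<in>F. - ((1 / mass i) * (pf n (m + 1) $ i \<bullet> I_FF m i)))
        + (\<Sum>i\<in>M. - ((1 / mass i) * (pf n (m + 1) $ i \<bullet> (I_FM m i + I_MM m i))))"
        unfolding sum.union_disjoint[OF finite finite disjoint] add_diff_add sum_subtractf[symmetric]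
        by (intro arg_cong2[where f = "(+)"] sum.cong refl leapfrog_kinetic_difference
            F_step(2)[OF _ m] M_step(2)[OF _ m])
      then show ?thesis
        by (simp only: sum_negf inner_add_right distrib_left sum.distrib)
    qed
    ultimately show ?thesis
      unfolding E_def add.assoc[of m] one_add_one by linarith
  qed
  have E_change: "E K - E 0 = (\<Sum>i\<in>S. (1 / mass i) * (ps (n + 1) $ i \<bullet> (\<Sum>m<K. I_MS m i)))"
  proof -
    have "E K - E 0 = (\<Sum>m<K. E (m + 1) - E m)"
      using sum_lessThan_telescope[of E K] by simp
    also have "\<dots> = (\<Sum>m<K. \<Sum>i\<in>S. (1 / mass i) * (ps (n + 1) $ i \<bullet> I_MS m i))"
      using E_step by (intro sum.cong) auto
    also have "\<dots> = (\<Sum>i\<in>S. (1 / mass i) * (ps (n + 1) $ i \<bullet> (\<Sum>m<K. I_MS m i)))"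
      by (subst sum.swap) (simp add: inner_sum_right sum_distrib_left)
    finally show ?thesis .
  qed
  have V_S_change: "V_S (block S (qs (n + 1))) - V_S (block S (qs n))
      = (\<Sum>i\<in>S. (1 / mass i) * (ps (n + 1) $ i \<bullet> I_SS i))"
    unfolding hatS_start[symmetric] hatS_end[symmetric] I_SS_def hat_coarse_def
    by (rule potential_difference[OF assms(6) coarse_le])
  have S_kinetic_change: "(\<Sum>i\<in>S. 1 / (2 * mass i) * (ps (n + 1) $ i \<bullet> ps (n + 2) $ i))
      - (\<Sum>i\<in>S. 1 / (2 * mass i) * (ps n $ i \<bullet> ps (n + 1) $ i))
      = (\<Sum>i\<in>S. - ((1 / mass i) * (ps (n + 1) $ i \<bullet> ((\<Sum>m<K. I_MS m i) + I_SS i))))"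
    unfolding sum_subtractf[symmetric]
    by (intro sum.cong refl leapfrog_kinetic_difference S_step(2))

  have "block F (qf (n + 1) 0) = block F (qf n K)" "block M (qf (n + 1) 0) = block M (qf n K)"
    using restart(1) by (auto intro!: block_cong)
  then have energy_next: "pseudo_energy S M F mass V_S V_M V_F qs ps qf pf (n + 1) =
      V_S (block S (qs (n + 1))) + (\<Sum>i\<in>S. 1 / (2 * mass i) * (ps (n + 1) $ i \<bullet> ps (n + 2) $ i)) + E K"
    using restart(2,3) by (simp add: pseudo_energy_def E_def tf_K hatS_end[simplified])
  have energy_now: "pseudo_energy S M F mass V_S V_M V_F qs ps qf pf n =
      V_S (block S (qs n)) + (\<Sum>i\<in>S. 1 / (2 * mass i) * (ps n $ i \<bullet> ps (n + 1) $ i)) + E 0"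
    by (simp add: pseudo_energy_def E_def tf_0 hatS_start)
  have "(\<Sum>i\<in>S. - ((1 / mass i) * (ps (n + 1) $ i \<bullet> ((\<Sum>m<K. I_MS m i) + I_SS i)))) =
      - (\<Sum>i\<in>S. (1 / mass i) * (ps (n + 1) $ i \<bullet> (\<Sum>m<K. I_MS m i)))
      - (\<Sum>i\<in>S. (1 / mass i) * (ps (n + 1) $ i \<bullet> I_SS i))"
    by (simp only: sum_negf inner_add_right distrib_left sum.distrib)
  with E_change V_S_change S_kinetic_change
  show "pseudo_energy S M F mass V_S V_M V_F qs ps qf pf (n + 1) =
        pseudo_energy S M F mass V_S V_M V_F qs ps qf pf n"
    unfolding energy_next energy_now by linarith
qed

end
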